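(* Let $s, c$ be positive integers with $c \le s$. Every configuration in $\mathcal{B}_{\textsc{ind}}(s,c,\mathbb{N}_+)$ with all parking spots initially empty is solvable.
   Context: Bus Out model. Fix a set of colors. A passenger queue is a finite sequence of colors. A parking spot is either empty, denoted $\varepsilon$, or occupied by a bus, written $(x,k)$ with $x$ a color and $k \ge 1$ the number of remaining seats. A spot occupancy state with $s$ spots is an $s$-tuple of spot states. A congestion graph is a finite directed graph whose vertices (buses) are labeled by (color, capacity) with capacity a positive integer; an edge $u\to v$ means bus $v$ blocks bus $u$. A vertex is free if its out-degree is $0$. A configuration is a triple $(G,Q,S)$; it is empty if $G$ and $Q$ are empty and all spots are $\varepsilon$. $(G,Q,S)$ can transition to $(G',Q',S')$ if either (1) $Q'=Q$, $G'$ is $G$ with a free vertex labeled $(x,k)$ removed, and $S'$ is $S$ with one entry $\varepsilon$ replaced by $(x,k)$; or (2) $G'=G$, $Q'$ is $Q$ with its first element $x$ removed, and $S'$ is $S$ with an entry $(x,k+1)$ replaced by $(x,k)$ for some $k\ge1$, or an entry $(x,1)$ replaced by $\varepsilon$. Whenever a type (2) transition is applicable, it is performed before any type (1) transition may be chosen. A configuration is solvable if some sequence of transitions leads to the empty configuration. A configuration is eligible if $G$ is acyclic and, for each color, the total capacity of buses of that color equals the number of passengers of that color. $\mathcal{B}(s,c,V)$ is the class of eligible configurations with exactly $s$ parking spots, at most $c$ colors, and bus capacities in $V$; $\mathcal{B}_{\textsc{ind}}(s,c,V)$ consists of those whose congestion graph has no edges. *)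

theory Defs
  imports "Graph_Theory.Digraph"
begin

text \<open>A bus is labelled by its colour and its number of (remaining) seats. An arc with tail \<open>u\<close> and
  head \<open>v\<close> means that bus \<open>v\<close> blocks bus \<open>u\<close>. Labels of non-vertices are irrelevant.\<close>

type_synonym 'c bus = "'c \<times> nat"

record ('v, 'e, 'c) congestion_graph =
  blocking :: "('v, 'e) pre_digraph"
  bus_label :: "'v \<Rightarrow> 'c bus"

abbreviation buses :: "('v, 'e, 'c) congestion_graph \<Rightarrow> 'v set" where
  "buses G \<equiv> verts (blocking G)"

definition congestion_graph :: "('v, 'e, 'c) congestion_graph \<Rightarrow> bool" where
  "congestion_graph G \<longleftrightarrow>
     fin_digraph (blocking G) \<and> nomulti_digraph (blocking G) \<and>
     (\<forall>v \<in> buses G. 1 \<le> snd (bus_label G v))"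

definition free_bus :: "('v, 'e, 'c) congestion_graph \<Rightarrow> 'v \<Rightarrow> bool" where
  "free_bus G v \<longleftrightarrow> v \<in> buses G \<and> out_degree (blocking G) v = 0"

definition remove_bus ::
  "('v, 'e, 'c) congestion_graph \<Rightarrow> 'v \<Rightarrow> ('v, 'e, 'c) congestion_graph" where
  "remove_bus G v = G\<lparr>blocking := pre_digraph.del_vert (blocking G) v\<rparr>"

text \<open>An empty parking spot \<open>\<epsilon>\<close> is \<open>None\<close>.\<close>

type_synonym 'c spot = "'c bus option"

type_synonym ('v, 'e, 'c) configuration =
  "('v, 'e, 'c) congestion_graph \<times> 'c list \<times> 'c spot list"

fun wf_configuration :: "('v, 'e, 'c) configuration \<Rightarrow> bool" where
  "wf_configuration (G, Q, S) \<longleftrightarrow>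
     congestion_graph G \<and> (\<forall>x k. Some (x, k) \<in> set S \<longrightarrow> 1 \<le> k)"

fun all_spots_empty :: "('v, 'e, 'c) configuration \<Rightarrow> bool" where
  "all_spots_empty (G, Q, S) \<longleftrightarrow> (\<forall>p \<in> set S. p = None)"

fun empty_configuration :: "('v, 'e, 'c) configuration \<Rightarrow> bool" where
  "empty_configuration (G, Q, S) \<longleftrightarrow> buses G = {} \<and> Q = [] \<and> (\<forall>p \<in> set S. p = None)"

inductive park :: "('v, 'e, 'c) configuration \<Rightarrow> ('v, 'e, 'c) configuration \<Rightarrow> bool" where
  "free_bus G v \<Longrightarrow> i < length S \<Longrightarrow> S ! i = None \<Longrightarrow>
     park (G, Q, S) (remove_bus G v, Q, S[i := Some (bus_label G v)])"

inductive board :: "('v, 'e, 'c) configuration \<Rightarrow> ('v, 'e, 'c) configuration \<Rightarrow> bool" where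
  board_seat: "i < length S \<Longrightarrow> S ! i = Some (x, k + 1) \<Longrightarrow> 1 \<le> k \<Longrightarrow>
     board (G, x # Q, S) (G, Q, S[i := Some (x, k)])"
| board_last: "i < length S \<Longrightarrow> S ! i = Some (x, 1) \<Longrightarrow>
     board (G, x # Q, S) (G, Q, S[i := None])"

text \<open>Boarding takes priority over parking.\<close>

definition transition :: "('v, 'e, 'c) configuration \<Rightarrow> ('v, 'e, 'c) configuration \<Rightarrow> bool" where
  "transition C C' \<longleftrightarrow> board C C' \<or> ((\<nexists>D. board C D) \<and> park C C')"

definition solvable :: "('v, 'e, 'c) configuration \<Rightarrow> bool" where
  "solvable C \<longleftrightarrow> (\<exists>C'. transition\<^sup>*\<^sup>* C C' \<and> empty_configuration C')"

text \<open>The seats available to a colour are those of the buses in the congestion graph together with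
  the remaining seats of the buses already parked.\<close>

definition graph_seats :: "('v, 'e, 'c) congestion_graph \<Rightarrow> 'c \<Rightarrow> nat" where
  "graph_seats G x = (\<Sum>v \<in> {v \<in> buses G. fst (bus_label G v) = x}. snd (bus_label G v))"

fun spot_seats :: "'c \<Rightarrow> 'c spot \<Rightarrow> nat" where
  "spot_seats x None = 0"
| "spot_seats x (Some (y, k)) = (if y = x then k else 0)"

fun eligible :: "('v, 'e, 'c) configuration \<Rightarrow> bool" where
  "eligible (G, Q, S) \<longleftrightarrow>
     acyclic (arcs_ends (blocking G)) \<and>
     (\<forall>x. graph_seats G x + (\<Sum>p \<leftarrow> S. spot_seats x p) = count_list Q x)"

fun colors :: "('v, 'e, 'c) configuration \<Rightarrow> 'c set" where
  "colors (G, Q, S) = (fst \<circ> bus_label G) ` buses G \<union> set Q \<union> {x. \<exists>k. Some (x, k) \<in> set S}"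

text \<open>The set \<open>V\<close> constrains the capacities in the congestion graph only: the numbers recorded in
  the parking spots are remaining seats, not capacities.\<close>

definition bus_out :: "nat \<Rightarrow> nat \<Rightarrow> nat set \<Rightarrow> ('v, 'e, 'c) configuration set" where
  "bus_out s c V = {(G, Q, S).
     wf_configuration (G, Q, S) \<and> eligible (G, Q, S) \<and>
     length S = s \<and> card (colors (G, Q, S)) \<le> c \<and>
     (\<forall>v \<in> buses G. snd (bus_label G v) \<in> V)}"

definition bus_out_ind :: "nat \<Rightarrow> nat \<Rightarrow> nat set \<Rightarrow> ('v, 'e, 'c) configuration set" where
  "bus_out_ind s c V = {(G, Q, S). (G, Q, S) \<in> bus_out s c V \<and> arcs (blocking G) = {}}"

end

theory Submission
  imports Defs
begin

text \<open>A bus is only ever parked when the first passenger has a colour that no parked bus has. Parked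
  buses then have pairwise distinct colours, all different from that of the first passenger, so
  with at least as many spots as colours a spot is empty; by the seat balance a bus of the wanted
  colour is still in the congestion graph, and it is free because there are no arcs. Every
  transition decreases the number of passengers plus the number of unparked buses.\<close>

text \<open>Phrased with indices, since two spots may hold the same pair \<open>(x, k)\<close>,
  which a condition on \<open>set S\<close> could not detect.\<close>

definition distinct_parked :: "'c spot list \<Rightarrow> bool" where
  "distinct_parked S \<longleftrightarrow>
     (\<forall>i < length S. \<forall>j < length S. \<forall>x k l. S ! i = Some (x, k) \<longrightarrow> S ! j = Some (x, l) \<longrightarrow> i = j)"

text \<open>The invariant of the strategy. The colours present may shrink along a run, so the fixed
  set \<open>K\<close> bounds them by inclusion and its cardinality never has to be recomputed.
  Finiteness of \<open>K\<close> is demanded because \<open>card\<close> is 0 on infinite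
  sets.\<close>

definition serviceable :: "'c set \<Rightarrow> ('v, 'e, 'c) configuration \<Rightarrow> bool" where
  "serviceable K = (\<lambda>(G, Q, S).
     finite (buses G) \<and> arcs (blocking G) = {} \<and> (\<forall>v \<in> buses G. 1 \<le> snd (bus_label G v)) \<and>
     (\<forall>x k. Some (x, k) \<in> set S \<longrightarrow> 1 \<le> k) \<and>
     (\<forall>x. graph_seats G x + (\<Sum>p \<leftarrow> S. spot_seats x p) = count_list Q x) \<and>
     distinct_parked S \<and> finite K \<and> card K \<le> length S \<and> colors (G, Q, S) \<subseteq> K)"

text \<open>The second premise covers all three uses: an emptied spot has no colour, a boarded bus
  keeps the colour it had at \<open>i\<close>, and a newly parked bus brings a colour that occurs
  nowhere.\<close>

lemma distinct_parked_update:
  assumes "distinct_parked S"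
    and "\<And>x k j l. q = Some (x, k) \<Longrightarrow> j < length S \<Longrightarrow> S ! j = Some (x, l) \<Longrightarrow> j = i"
  shows "distinct_parked (S[i := q])"
proof -
  have nth: "S[i := q] ! j = (if j = i then q else S ! j)" if "j < length S" for j
    using that by auto
  show ?thesis
    unfolding distinct_parked_def length_list_update
  proof (intro allI impI)
    fix j m x k l
    assume "j < length S" "m < length S"
      "S[i := q] ! j = Some (x, k)" "S[i := q] ! m = Some (x, l)"
    then show "j = m"
      using assms unfolding distinct_parked_def nth[OF \<open>j < length S\<close>] nth[OF \<open>m < length S\<close>]
      by (metis (full_types))
  qed
qed

text \<open>The old entry is added on the left rather than subtracted on the right, which avoids
  truncated subtraction on naturals.\<close>

lemma spot_seats_list_update:
  assumes "i < length S"
  shows "(\<Sum>p \<leftarrow> S[i := q]. spot_seats x p) + spot_seats x (S ! i) =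
    (\<Sum>p \<leftarrow> S. spot_seats x p) + spot_seats x q"
  using assms
proof (induction S arbitrary: i)
  case (Cons p S)
  then show ?case by (cases i) (auto simp: add_ac)
qed simp

text \<open>The lost seats are written with \<open>spot_seats\<close>, so that they cancel against
  the seats gained by the spot and parking preserves the balance.\<close>

lemma graph_seats_remove_bus:
  assumes "finite (buses G)" and "v \<in> buses G"
  shows "graph_seats (remove_bus G v) x + spot_seats x (Some (bus_label G v)) = graph_seats G x"
proof (cases "fst (bus_label G v) = x")
  case True
  let ?A = "{u \<in> buses G. fst (bus_label G u) = x}"
  have "{u \<in> buses (remove_bus G v). fst (bus_label (remove_bus G v) u) = x} = ?A - {v}"
    by (auto simp: remove_bus_def pre_digraph.del_vert_def)
  moreover have "sum (\<lambda>u. snd (bus_label G u)) ?A =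
      snd (bus_label G v) + sum (\<lambda>u. snd (bus_label G u)) (?A - {v})"
    using assms True by (intro sum.remove) auto
  ultimately show ?thesis
    using True by (cases "bus_label G v") (simp add: graph_seats_def remove_bus_def)
next
  case False
  then have "{u \<in> buses (remove_bus G v). fst (bus_label (remove_bus G v) u) = x} =
      {u \<in> buses G. fst (bus_label G u) = x}"
    by (auto simp: remove_bus_def pre_digraph.del_vert_def)
  then show ?thesis
    using False by (cases "bus_label G v") (simp add: graph_seats_def remove_bus_def)
qed

lemma color_parkedD:
  assumes "serviceable K (G, Q, S)" and "Some (x, k) \<in> set S"
  shows "x \<in> K"
  using assms by (auto simp: serviceable_def)

text \<open>With an empty queue the balance forces every seat count to be 0, while each remaining
  bus, parked or not, has at least one seat.\<close>

lemma serviceable_no_passengers: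
  assumes "serviceable K (G, [], S)"
  shows "empty_configuration (G, [], S)"
proof -
  have bal: "graph_seats G x = 0" "\<forall>p \<in> set S. spot_seats x p = 0" for x
    using assms by (auto simp: serviceable_def sum_list_eq_0_iff)
  have "v \<notin> buses G" for v
  proof
    assume v: "v \<in> buses G"
    have "finite {u \<in> buses G. fst (bus_label G u) = fst (bus_label G v)}"
      using assms by (simp add: serviceable_def)
    with bal(1)[of "fst (bus_label G v)"] v have "snd (bus_label G v) = 0"
      by (simp add: graph_seats_def)
    with v assms show False by (auto simp: serviceable_def)
  qed
  moreover have "p = None" if "p \<in> set S" for p
  proof (cases p)
    case (Some b)
    obtain x k where "b = (x, k)" by (cases b)
    with that Some have "Some (x, k) \<in> set S" by simp
    moreover from this have "k = 0" using bal(2)[of x] by force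
    ultimately show ?thesis using assms by (force simp: serviceable_def)
  qed simp
  ultimately show ?thesis by auto
qed

lemma serviceable_board:
  assumes inv: "serviceable K (G, x # Q, S)" and "Some (x, k) \<in> set S"
  shows "\<exists>S'. board (G, x # Q, S) (G, Q, S') \<and> serviceable K (G, Q, S')"
proof -
  obtain i where i: "i < length S" "S ! i = Some (x, k)"
    using assms(2) by (auto simp: in_set_conv_nth)
  have "1 \<le> k" using assms by (auto simp: serviceable_def)
  \<comment> \<open>One expression for the results of both boarding rules; in either case the spot
    keeps \<open>k - 1\<close> seats of colour \<open>x\<close>, with \<open>None\<close> counting
    as 0.\<close>
  define q where "q = (if k = 1 then None else Some (x, k - 1))"
  have "board (G, x # Q, S) (G, Q, S[i := q])"
  proof (cases "k = 1")
    case True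
    then show ?thesis using i by (auto simp: q_def intro: board.intros)
  next
    case False
    then have "k = (k - 1) + 1" "1 \<le> k - 1" using \<open>1 \<le> k\<close> by auto
    then show ?thesis
      using board_seat[of i S x "k - 1" G Q] i False by (simp add: q_def)
  qed
  moreover have "serviceable K (G, Q, S[i := q])"
  proof -
    have "graph_seats G y + (\<Sum>p \<leftarrow> S[i := q]. spot_seats y p) = count_list Q y" for y
    proof -
      have "graph_seats G y + (\<Sum>p \<leftarrow> S. spot_seats y p) = count_list (x # Q) y"
        using inv by (simp add: serviceable_def)
      then show ?thesis
        using spot_seats_list_update[OF i(1), where q = q and x = y] i(2) \<open>1 \<le> k\<close>
        by (auto simp: q_def split: if_splits)
    qed
    moreover have "distinct_parked (S[i := q])"
    proof (rule distinct_parked_update)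
      show "distinct_parked S" using inv by (simp add: serviceable_def)
      \<comment> \<open>If \<open>q\<close> is a bus, its colour is \<open>x\<close>, and spot
        \<open>i\<close> was already the only one with that colour.\<close>
      then show "j = i" if "q = Some (y, m)" "j < length S" "S ! j = Some (y, l)" for y m j l
        using that i unfolding distinct_parked_def q_def by (auto split: if_splits)
    qed
    moreover have "1 \<le> m \<and> y \<in> K" if "Some (y, m) \<in> set (S[i := q])" for y m
    proof (cases "Some (y, m) = q")
      case True
      then show ?thesis
        using \<open>1 \<le> k\<close> color_parkedD[OF inv assms(2)] by (auto simp: q_def split: if_splits)
    next
      case False
      then have "Some (y, m) \<in> set S" using that set_update_subset_insert[of S i q] by auto
      then show ?thesis using inv color_parkedD[OF inv] by (auto simp: serviceable_def)
    qed
    moreover have "(fst \<circ> bus_label G) ` buses G \<subseteq> K" "set Q \<subseteq> K"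
      using inv by (auto simp: serviceable_def)
    ultimately show ?thesis
      using inv unfolding serviceable_def by auto
  qed
  ultimately show ?thesis by blast
qed

text \<open>An empty spot comes from the pigeonhole principle, a bus of colour \<open>x\<close> from
  the seat balance.\<close>

lemma serviceable_park:
  assumes inv: "serviceable K (G, x # Q, S)" and new: "\<And>k. Some (x, k) \<notin> set S"
  shows "\<exists>v S'. v \<in> buses G \<and> park (G, x # Q, S) (remove_bus G v, x # Q, S') \<and>
    serviceable K (remove_bus G v, x # Q, S')"
proof -
  have "\<exists>i < length S. S ! i = None"
  proof (rule ccontr)
    assume "\<not> ?thesis"
    then have occ: "\<exists>y k. S ! i = Some (y, k)" if "i < length S" for i
      using that by (cases "S ! i") auto
    \<comment> \<open>Were all spots occupied, sending each spot to the colour of its bus would be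
      injective by \<open>distinct_parked\<close>.\<close>
    define f where "f i = fst (the (S ! i))" for i
    have f: "\<exists>k. S ! i = Some (f i, k)" if "i < length S" for i
      using occ[OF that] by (auto simp: f_def)
    have "inj_on f {..<length S}"
    proof (rule inj_onI)
      fix i j assume "i \<in> {..<length S}" "j \<in> {..<length S}" "f i = f j"
      then show "i = j"
        using f[of i] f[of j] inv unfolding serviceable_def distinct_parked_def by auto
    qed
    \<comment> \<open>No parked bus has colour \<open>x\<close>, so the target loses an element of
      \<open>K\<close> and is smaller than the number of spots.\<close>
    moreover have "f ` {..<length S} \<subseteq> K - {x}"
    proof
      fix y assume "y \<in> f ` {..<length S}"
      then obtain k where "Some (y, k) \<in> set S" using f by (auto simp: in_set_conv_nth) metis
      then show "y \<in> K - {x}" using new color_parkedD[OF inv] by auto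
    qed
    moreover have "finite K" "x \<in> K" "card K \<le> length S"
      using inv by (auto simp: serviceable_def)
    ultimately have "length S \<le> card (K - {x})"
      using card_inj_on_le[of f "{..<length S}" "K - {x}"] by (simp del: card_Diff_insert card_Diff_singleton)
    moreover have "card (K - {x}) < card K"
      using \<open>finite K\<close> \<open>x \<in> K\<close> by (rule card_Diff1_less)
    ultimately show False using \<open>card K \<le> length S\<close> by simp
  qed
  then obtain i where i: "i < length S" "S ! i = None" by blast
  have bal: "graph_seats G y + (\<Sum>p \<leftarrow> S. spot_seats y p) = count_list (x # Q) y" for y
    using inv by (simp add: serviceable_def)
  \<comment> \<open>The parked buses offer no seat to the first passenger, so the balance at
    \<open>x\<close> puts a positive number of seats into the graph.\<close>
  have "spot_seats x p = 0" if "p \<in> set S" for p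
    using that new by (cases "(x, p)" rule: spot_seats.cases) auto
  then have "(\<Sum>p \<leftarrow> S. spot_seats x p) = 0" by (simp add: sum_list_eq_0_iff)
  with bal[of x] have "graph_seats G x \<noteq> 0" by simp
  then obtain v where v: "v \<in> buses G" "fst (bus_label G v) = x"
    unfolding graph_seats_def by (rule sum.not_neutral_contains_not_neutral) blast
  let ?S = "S[i := Some (bus_label G v)]"
  have "free_bus G v"
    using v inv by (simp add: free_bus_def out_degree_def out_arcs_def serviceable_def)
  then have "park (G, x # Q, S) (remove_bus G v, x # Q, ?S)"
    using i by (rule park.intros)
  moreover have "serviceable K (remove_bus G v, x # Q, ?S)"
  proof -
    have fin: "finite (buses G)" using inv by (simp add: serviceable_def)
    have "graph_seats (remove_bus G v) y + (\<Sum>p \<leftarrow> ?S. spot_seats y p) = count_list (x # Q) y" for y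
      using bal[of y] graph_seats_remove_bus[OF fin v(1), of y]
        spot_seats_list_update[OF i(1), where q = "Some (bus_label G v)" and x = y] i(2) by simp
    moreover have "distinct_parked ?S"
      using inv v(2) new by (intro distinct_parked_update) (auto simp: serviceable_def in_set_conv_nth)
    moreover have "1 \<le> m \<and> y \<in> K" if "Some (y, m) \<in> set ?S" for y m
    proof (cases "(y, m) = bus_label G v")
      case True
      have "1 \<le> snd (bus_label G v)" "fst (bus_label G v) \<in> K"
        using inv v(1) by (auto simp: serviceable_def)
      then show ?thesis by (simp flip: True)
    next
      case False
      then have "Some (y, m) \<in> set S"
        using that set_update_subset_insert[of S i "Some (bus_label G v)"] by auto
      then show ?thesis using inv color_parkedD[OF inv] by (auto simp: serviceable_def)
    qed
    moreover have "(fst \<circ> bus_label G) ` buses G \<subseteq> K" "set (x # Q) \<subseteq> K"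
      using inv by (auto simp: serviceable_def)
    moreover have "buses (remove_bus G v) = buses G - {v}"
      "arcs (blocking (remove_bus G v)) \<subseteq> arcs (blocking G)"
      "bus_label (remove_bus G v) = bus_label G"
      by (auto simp: remove_bus_def pre_digraph.del_vert_def)
    ultimately show ?thesis
      using inv unfolding serviceable_def by auto
  qed
  ultimately show ?thesis using v(1) by blast
qed

text \<open>Needed in contrapositive form: it shows that boarding, which has priority, is impossible
  at the moment a bus is to be parked.\<close>

lemma board_first_passenger_parked:
  "board (G, x # Q, S) D \<Longrightarrow> \<exists>k. Some (x, k) \<in> set S"
  by (erule board.cases) (auto simp: in_set_conv_nth)

lemma solvable_transition:
  "transition C D \<Longrightarrow> solvable D \<Longrightarrow> solvable C"
  unfolding solvable_def by (meson converse_rtranclp_into_rtranclp)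

lemma serviceable_solvable:
  assumes "serviceable K (G, Q, S)"
  shows "solvable (G, Q, S)"
  using assms
proof (induction "length Q + card (buses G)" arbitrary: G Q S rule: less_induct)
  case less
  show ?case
  proof (cases Q)
    case Nil
    then show ?thesis
      using serviceable_no_passengers less.prems unfolding solvable_def by blast
  next
    case (Cons x Q')
    show ?thesis
    proof (cases "\<exists>k. Some (x, k) \<in> set S")
      case True
      then obtain k where "Some (x, k) \<in> set S" by blast
      with less.prems obtain S' where S': "board (G, x # Q', S) (G, Q', S')" "serviceable K (G, Q', S')"
        unfolding Cons using serviceable_board[of K G x Q' S k] by auto
      then have "solvable (G, Q', S')" using less.hyps Cons by simp
      moreover have "transition (G, Q, S) (G, Q', S')"
        using S'(1) Cons by (simp add: transition_def)
      ultimately show ?thesis by (rule solvable_transition[rotated])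
    next
      case False
      then obtain v S' where S': "v \<in> buses G" "park (G, Q, S) (remove_bus G v, Q, S')"
        "serviceable K (remove_bus G v, Q, S')"
        using serviceable_park[of K G x Q' S] less.prems Cons by auto
      have "buses (remove_bus G v) = buses G - {v}"
        by (simp add: remove_bus_def pre_digraph.del_vert_def)
      moreover have "finite (buses G)" using less.prems by (simp add: serviceable_def)
      ultimately have "card (buses (remove_bus G v)) < card (buses G)"
        using S'(1) by (simp add: card_Diff1_less del: card_Diff_insert)
      then have "solvable (remove_bus G v, Q, S')" using less.hyps S'(3) by simp
      \<comment> \<open>Parking is permitted here because no bus of colour \<open>x\<close> is
        parked, hence no boarding step applies.\<close>
      moreover have "transition (G, Q, S) (remove_bus G v, Q, S')"
        using S'(2) False Cons board_first_passenger_parked[of G x Q' S]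
        unfolding transition_def by auto
      ultimately show ?thesis by (rule solvable_transition[rotated])
    qed
  qed
qed

theorem theorem7:
  fixes s c :: nat and C :: "('v, 'e, 'c) configuration"
  assumes "0 < s" and "0 < c" and "c \<le> s"
    and "C \<in> bus_out_ind s c {n. 0 < n}"
    and "all_spots_empty C"
  shows "solvable C"
proof -
  obtain G Q S where C: "C = (G, Q, S)" by (cases C)
  have S: "\<forall>p \<in> set S. p = None" using assms(5) C by simp
  then have "distinct_parked S" by (force simp: distinct_parked_def in_set_conv_nth)
  moreover have fin: "finite (buses G)"
    using assms(4) C
    by (auto simp: bus_out_ind_def bus_out_def congestion_graph_def intro: fin_digraph.finite_verts)
  moreover have "{x. \<exists>k. Some (x, k) \<in> set S} = {}" using S by auto
  then have "finite (colors (G, Q, S))" using fin by simp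
  \<comment> \<open>The initial colours serve as \<open>K\<close>; their number is at most
    \<open>c\<close>, hence at most \<open>s\<close>, the number of spots.\<close>
  ultimately have "serviceable (colors (G, Q, S)) (G, Q, S)"
    using assms(3,4) C
    by (auto simp: serviceable_def bus_out_ind_def bus_out_def congestion_graph_def simp del: colors.simps)
  then show ?thesis using serviceable_solvable C by blast
qed

end
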